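(* Let $0<\mu<16/17$ and $c_J=-1-2\sqrt{\mu(1-\mu)}$. Then there exists $\varepsilon>0$ such that for every $c\in(c_J-\varepsilon,c_J)$ the image of the regularized Earth component under the Levi-Civita embedding, i.e. the hypersurface $\overline{\Sigma}{}_c^E\subset K_c^{-1}(0)\subset\mathbb{R}^4$, is not convex.
   Context: Euler problem of two fixed centers: $E=(0,0)$, $M=(1,0)$, $\mu\in(0,1)$, and $H(q,p)=\frac12|p|^2-\frac{1-\mu}{|q-E|}-\frac{\mu}{|q-M|}$. The critical Jacobi energy is $c_J=-1-2\sqrt{\mu(1-\mu)}$; for $c<c_J$ the set $H^{-1}(c)$ has two bounded components, one of which, $\Sigma_c^E$, projects to a neighborhood of $E$ (punctured at $E$). Levi-Civita coordinates $(v,u)\in\mathbb{C}^2\cong\mathbb{R}^4$ are given by $q=2v^2$, $p=u/\overline{v}$. With $v=v_1+iv_2$, the regularized Hamiltonian is $$K_c(v,u)=|v|^2(H-c)=\frac12|u|^2-c|v|^2-\frac{\mu|v|^2}{\sqrt{4v_1^4+8v_1^2v_2^2-4v_1^2+4v_2^4+4v_2^2+1}}-\frac{1-\mu}{2}.$$ The Levi-Civita image of the regularized Earth component, $\overline{\Sigma}{}_c^E\subset K_c^{-1}(0)$, is the compact connected component of $K_c^{-1}(0)$ whose projection to the $v$-plane contains $v=0$; it is diffeomorphic to $S^3$. "Convex" means strictly convex: the hypersurface bounds a strictly convex domain in $\mathbb{R}^4$, in the sense that its second fundamental form (with respect to the suitable unit normal) is positive definite at every point. *)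

theory Defs
  imports "HOL-Analysis.Analysis"
begin

definition earth :: complex where
  "earth = 0"

definition moon :: complex where
  "moon = 1"

definition euler_hamiltonian :: "real \<Rightarrow> complex \<Rightarrow> complex \<Rightarrow> real" where
  "euler_hamiltonian \<mu> q p =
     (norm p)\<^sup>2 / 2 - (1 - \<mu>) / norm (q - earth) - \<mu> / norm (q - moon)"

definition critical_energy :: "real \<Rightarrow> real" where
  "critical_energy \<mu> = - 1 - 2 * sqrt (\<mu> * (1 - \<mu>))"

text \<open>
  The radicand is the square of the norm of \<open>2 * v\<^sup>2 - 1\<close>, so the formula is meaningful for
  \<open>2 * v\<^sup>2 \<noteq> 1\<close>, that is, away from the collisions with the moon; it is smooth at \<open>v = 0\<close>.
\<close>

definition regularized_hamiltonian :: "real \<Rightarrow> real \<Rightarrow> complex \<times> complex \<Rightarrow> real" where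
  "regularized_hamiltonian \<mu> c = (\<lambda>(v, u).
     (norm u)\<^sup>2 / 2 - c * (norm v)\<^sup>2
     - \<mu> * (norm v)\<^sup>2 /
         sqrt (4 * Re v ^ 4 + 8 * (Re v)\<^sup>2 * (Im v)\<^sup>2 - 4 * (Re v)\<^sup>2
               + 4 * Im v ^ 4 + 4 * (Im v)\<^sup>2 + 1)
     - (1 - \<mu>) / 2)"

lemma norm_levi_civita_moon:
  "norm (2 * v\<^sup>2 - moon) =
     sqrt (4 * Re v ^ 4 + 8 * (Re v)\<^sup>2 * (Im v)\<^sup>2 - 4 * (Re v)\<^sup>2
           + 4 * Im v ^ 4 + 4 * (Im v)\<^sup>2 + 1)"
  unfolding cmod_def moon_def
  by (rule arg_cong[where f = sqrt])
     (simp add: power2_eq_square power4_eq_xxxx algebra_simps)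

lemma regularized_hamiltonian_eq:
  assumes "v \<noteq> 0"
  shows "regularized_hamiltonian \<mu> c (v, u) =
           (norm v)\<^sup>2 * (euler_hamiltonian \<mu> (2 * v\<^sup>2) (u / cnj v) - c)"
proof -
  have "(norm v)\<^sup>2 * ((norm (u / cnj v))\<^sup>2 / 2) = (norm u)\<^sup>2 / 2"
    using assms by (simp add: norm_divide power_divide)
  moreover have "(norm v)\<^sup>2 * ((1 - \<mu>) / norm (2 * v\<^sup>2 - earth)) = (1 - \<mu>) / 2"
    using assms by (simp add: earth_def norm_mult norm_power)
  ultimately show ?thesis
    unfolding regularized_hamiltonian_def euler_hamiltonian_def norm_levi_civita_moon
    by (simp add: right_diff_distrib mult.commute[of \<mu>])
qed

text \<open>
  The points with \<open>2 * v\<^sup>2 = 1\<close> lie outside the domain of the regularized Hamiltonian; they are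
  removed explicitly because division by zero is total.
\<close>

definition regularized_energy_surface :: "real \<Rightarrow> real \<Rightarrow> (complex \<times> complex) set" where
  "regularized_energy_surface \<mu> c =
     {(v, u). 2 * v\<^sup>2 \<noteq> moon \<and> regularized_hamiltonian \<mu> c (v, u) = 0}"

definition regularized_earth_component :: "real \<Rightarrow> real \<Rightarrow> (complex \<times> complex) set" where
  "regularized_earth_component \<mu> c =
     (THE C. C \<in> components (regularized_energy_surface \<mu> c) \<and> compact C \<and> 0 \<in> fst ` C)"

text \<open>
  Extrinsic geometry of a regular hypersurface \<open>S\<close> of a Euclidean space. The derivative of a
  normal field within \<open>S\<close> is uniquely determined only in directions tangent to \<open>S\<close>, so the
  second fundamental form is used only on tangent vectors. Its sign is the one for which a round
  sphere has positive definite second fundamental form with respect to the inner normal.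
\<close>

definition tangent_vectors :: "'a::euclidean_space set \<Rightarrow> 'a \<Rightarrow> 'a set" where
  "tangent_vectors S x =
     {X. \<exists>\<gamma> e. e > 0 \<and> (\<forall>t\<in>{-e<..<e}. \<gamma> t \<in> S) \<and> \<gamma> 0 = x \<and>
          (\<gamma> has_vector_derivative X) (at (0::real))}"

definition unit_normal_field :: "'a::euclidean_space set \<Rightarrow> ('a \<Rightarrow> 'a) \<Rightarrow> bool" where
  "unit_normal_field S \<nu> \<longleftrightarrow>
     \<nu> differentiable_on S \<and>
     (\<forall>x\<in>S. norm (\<nu> x) = 1 \<and> (\<forall>X\<in>tangent_vectors S x. \<nu> x \<bullet> X = 0))"

definition second_fundamental_form ::
    "'a::euclidean_space set \<Rightarrow> ('a \<Rightarrow> 'a) \<Rightarrow> 'a \<Rightarrow> 'a \<Rightarrow> 'a \<Rightarrow> real" where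
  "second_fundamental_form S \<nu> x X Y = - (frechet_derivative \<nu> (at x within S) X \<bullet> Y)"

definition strictly_convex_hypersurface :: "'a::euclidean_space set \<Rightarrow> bool" where
  "strictly_convex_hypersurface S \<longleftrightarrow>
     (\<exists>\<nu>. unit_normal_field S \<nu> \<and>
          (\<forall>x\<in>S. \<forall>X\<in>tangent_vectors S x. X \<noteq> 0 \<longrightarrow> second_fundamental_form S \<nu> x X X > 0))"

end

theory Submission
  imports Defs
begin

text \<open>
  The regularized surface has the form \<open>(norm u)\<^sup>2 = 2 * W v\<close>. Since
  \<open>II(\<gamma>', \<gamma>') = \<nu> \<bullet> \<gamma>''\<close> for every curve \<open>\<gamma>\<close> on the surface, the circle obtained by
  rotating \<open>u\<close> and the lift of a line in the \<open>v\<close>-plane along which \<open>sqrt W\<close> has positive second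
  derivative get opposite signs of \<open>II\<close>, whichever normal is chosen. So it suffices to find
  a line in the Hill region along which \<open>2 * W * W'' > W'\<^sup>2\<close> at some point.

  At the critical energy, \<open>W\<close> has a saddle at the Lagrange point with quadratic part
  proportional to \<open>2 * a\<^sup>2 - b\<^sup>2\<close> in the direction \<open>a + \<i> * b\<close>. Along a line through the saddle
  \<open>2 * W * W'' - W'\<^sup>2\<close> vanishes there and has derivative \<open>2 * W * W'''\<close>, so a direction pointing
  into the Earth region with positive cubic part is enough. Such a direction
  exists near the boundary of the cone exactly if the Lagrange point is farther than \<open>1 / 5\<close> from
  the Earth, that is, if \<open>\<mu> < 16 / 17\<close>. The inequality is open, so it persists for energies slightly
  below the critical one. The Earth component is connected because \<open>W \<ge> 0\<close> propagates along rays
  towards the Earth, and is compact because \<open>W < 0\<close> on the circle through the Lagrange point.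
\<close>

section \<open>Second fundamental form along curves\<close>

text \<open>Velocities of curves on the surface are orthogonal to the normal, so
  \<open>\<nu> (\<gamma> t) \<bullet> \<gamma>1 t\<close> vanishes near \<open>a\<close>.
  Differentiating this at \<open>a\<close> trades the derivative of the normal for the acceleration
  of the curve.\<close>

lemma second_fundamental_form_curve:
  fixes \<gamma> :: "real \<Rightarrow> 'a::euclidean_space"
  assumes nu: "unit_normal_field S \<nu>" and e: "e > 0"
    and S: "\<And>t. \<bar>t - a\<bar> < e \<Longrightarrow> \<gamma> t \<in> S"
    and d1: "\<And>t. \<bar>t - a\<bar> < e \<Longrightarrow> (\<gamma> has_vector_derivative \<gamma>1 t) (at t)"
    and d2: "(\<gamma>1 has_vector_derivative \<gamma>2) (at a)"
  shows "\<gamma>1 a \<in> tangent_vectors S (\<gamma> a)"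
    and "second_fundamental_form S \<nu> (\<gamma> a) (\<gamma>1 a) (\<gamma>1 a) = \<nu> (\<gamma> a) \<bullet> \<gamma>2"
proof -
  \<comment> \<open>Tangency is required at all nearby parameters because the orthogonality is
    differentiated in \<open>t\<close>. Curves in \<open>tangent_vectors\<close> are based at 0,
    hence the shift.\<close>
  have tangent: "\<gamma>1 t \<in> tangent_vectors S (\<gamma> t)" if t: "\<bar>t - a\<bar> < e" for t
  proof -
    have "((\<lambda>s. \<gamma> (t + s)) has_vector_derivative \<gamma>1 t) (at 0)"
    proof -
      have "((\<lambda>s. t + s) has_vector_derivative 1) (at 0)"
        by (auto intro!: derivative_eq_intros)
      from vector_diff_chain_at[OF this, of \<gamma> "\<gamma>1 t"] d1[OF t] show ?thesis
        by (simp add: o_def)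
    qed
    moreover have "\<forall>s\<in>{-(e - \<bar>t - a\<bar>)<..<e - \<bar>t - a\<bar>}. \<gamma> (t + s) \<in> S"
      by (auto intro!: S)
    ultimately show ?thesis
      unfolding tangent_vectors_def using t
      by (intro CollectI exI[of _ "\<lambda>s. \<gamma> (t + s)"] exI[of _ "e - \<bar>t - a\<bar>"]) auto
  qed
  show "\<gamma>1 a \<in> tangent_vectors S (\<gamma> a)"
    using tangent[of a] e by simp
  have S_a: "\<gamma> a \<in> S"
    using S[of a] e by simp
  define D where "D = frechet_derivative \<nu> (at (\<gamma> a) within S)"
  have D: "(\<nu> has_derivative D) (at (\<gamma> a) within S)"
    using nu S_a unfolding unit_normal_field_def differentiable_on_def D_def
    by (simp add: frechet_derivative_works)
  \<comment> \<open>\<open>\<nu>\<close> is differentiable only within \<open>S\<close>, so the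
    chain rule is applied on an open interval that \<open>\<gamma>\<close> maps into
    \<open>S\<close>.\<close>
  let ?I = "{a - e<..<a + e}"
  have opn: "open ?I" "a \<in> ?I"
    using e by auto
  have "(\<gamma> has_derivative (\<lambda>s. s *\<^sub>R \<gamma>1 a)) (at a within ?I)"
    using d1[of a] e by (simp add: has_vector_derivative_def has_derivative_at_withinI)
  moreover have "(\<nu> has_derivative D) (at (\<gamma> a) within \<gamma> ` ?I)"
    by (rule has_derivative_subset[OF D]) (auto intro!: S)
  ultimately have "((\<nu> \<circ> \<gamma>) has_derivative (D \<circ> (\<lambda>s. s *\<^sub>R \<gamma>1 a))) (at a within ?I)"
    by (rule diff_chain_within)
  then have nd: "((\<lambda>t. \<nu> (\<gamma> t)) has_derivative (\<lambda>s. D (s *\<^sub>R \<gamma>1 a))) (at a)"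
    unfolding at_within_open[OF opn(2,1)] o_def .
  have "((\<lambda>t. \<nu> (\<gamma> t) \<bullet> \<gamma>1 t) has_derivative
          (\<lambda>s. \<nu> (\<gamma> a) \<bullet> (s *\<^sub>R \<gamma>2) + D (s *\<^sub>R \<gamma>1 a) \<bullet> \<gamma>1 a)) (at a)"
    by (rule has_derivative_inner[OF nd d2[unfolded has_vector_derivative_def]])
  moreover have "((\<lambda>t. \<nu> (\<gamma> t) \<bullet> \<gamma>1 t) has_derivative (\<lambda>s. 0)) (at a)"
  proof (rule has_derivative_transform_within_open[OF has_derivative_const opn])
    fix t assume "t \<in> ?I"
    then have "\<bar>t - a\<bar> < e" by auto
    from S[OF this] tangent[OF this] nu show "0 = \<nu> (\<gamma> t) \<bullet> \<gamma>1 t"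
      unfolding unit_normal_field_def by simp
  qed
  ultimately have "(\<lambda>s. \<nu> (\<gamma> a) \<bullet> (s *\<^sub>R \<gamma>2) + D (s *\<^sub>R \<gamma>1 a) \<bullet> \<gamma>1 a) = (\<lambda>s. 0)"
    by (rule has_derivative_unique)
  from fun_cong[OF this, of 1]
  show "second_fundamental_form S \<nu> (\<gamma> a) (\<gamma>1 a) (\<gamma>1 a) = \<nu> (\<gamma> a) \<bullet> \<gamma>2"
    unfolding second_fundamental_form_def D_def by simp
qed

section \<open>One-variable jets\<close>

text \<open>If \<open>g1\<close> is the derivative of \<open>g\<close> near \<open>a\<close>, the
  function differentiated here is the derivative of \<open>sqrt (g t)\<close>; the sign of the
  second derivative is then that of the numerator.\<close>

lemma second_derivative_sqrt:
  fixes g g1 :: "real \<Rightarrow> real"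
  assumes "g a > 0" and "(g has_real_derivative g1 a) (at a)"
    and "(g1 has_real_derivative g2) (at a)"
  shows "((\<lambda>t. g1 t / (2 * sqrt (g t))) has_real_derivative
           (2 * g a * g2 - (g1 a)\<^sup>2) / (4 * g a * sqrt (g a))) (at a)"
proof -
  have "sqrt (g a) > 0" "g a = sqrt (g a) * sqrt (g a)"
    using assms(1) by auto
  then show ?thesis
    using assms
    by (auto intro!: derivative_eq_intros) (simp add: field_simps power2_eq_square)
qed

lemma DERIV_positive_right:
  fixes f f' :: "real \<Rightarrow> real"
  assumes "f 0 \<ge> 0" and d: "\<And>t. \<bar>t\<bar> < m \<Longrightarrow> (f has_real_derivative f' t) (at t)"
    and pos: "\<And>t. 0 < t \<Longrightarrow> t < m \<Longrightarrow> f' t > 0" and t: "0 < t" "t < m"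
  shows "f t > 0"
proof -
  have "continuous_on {0..t} f"
    using t by (intro continuous_at_imp_continuous_on ballI DERIV_isCont[OF d]) auto
  moreover have "\<exists>y. (f has_real_derivative y) (at s) \<and> 0 < y" if "0 < s" "s < t" for s
    using d[of s] pos[of s] that t by auto
  ultimately have "f 0 < f t"
    by (rule DERIV_pos_imp_increasing_open[OF t(1), rotated])
  with \<open>f 0 \<ge> 0\<close> show ?thesis by simp
qed

text \<open>Positivity of \<open>w3\<close> near 0 is integrated three times to the right. The
  expression \<open>2 * w * w2 - w1\<^sup>2\<close> vanishes at 0, and in its derivative the terms
  \<open>2 * w1 * w2\<close> cancel, leaving \<open>2 * w * w3\<close>.\<close>

lemma positive_jet:
  fixes w w1 w2 w3 :: "real \<Rightarrow> real"
  assumes \<delta>: "\<delta> > 0"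
    and d0: "\<And>t. \<bar>t\<bar> < \<delta> \<Longrightarrow> (w has_real_derivative w1 t) (at t)"
    and d1: "\<And>t. \<bar>t\<bar> < \<delta> \<Longrightarrow> (w1 has_real_derivative w2 t) (at t)"
    and d2: "\<And>t. \<bar>t\<bar> < \<delta> \<Longrightarrow> (w2 has_real_derivative w3 t) (at t)"
    and "isCont w3 0" and z: "w 0 = 0" "w1 0 = 0" "w2 0 > 0" "w3 0 > 0"
  shows "\<forall>\<^sub>F t in at_right 0. w t > 0 \<and> 2 * w t * w2 t > (w1 t)\<^sup>2"
proof -
  have "\<forall>\<^sub>F t in nhds 0. w3 t > 0"
    using assms(5) z(4) unfolding isCont_def by (auto simp: tendsto_at_iff_tendsto_nhds dest: order_tendstoD)
  then obtain \<eta> where \<eta>: "\<eta> > 0" "\<And>t. \<bar>t\<bar> < \<eta> \<Longrightarrow> w3 t > 0"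
    by (auto simp: eventually_nhds_metric dist_real_def)
  define m where "m = min \<eta> \<delta>"
  have m: "m > 0" "\<And>t. \<bar>t\<bar> < m \<Longrightarrow> \<bar>t\<bar> < \<delta> \<and> \<bar>t\<bar> < \<eta>"
    using \<delta> \<eta>(1) by (auto simp: m_def)
  have w3_pos: "w3 t > 0" if "0 < t" "t < m" for t
    using m(2)[of t] \<eta>(2) that by simp
  have pos2: "w2 t > 0" if "0 < t" "t < m" for t
    by (rule DERIV_positive_right[where f = w2 and f' = w3 and m = m and t = t]) (use z d2 m w3_pos that in auto)
  have pos1: "w1 t > 0" if "0 < t" "t < m" for t
    by (rule DERIV_positive_right[where f = w1 and f' = w2 and m = m and t = t]) (use z d1 m pos2 that in auto)
  have pos0: "w t > 0" if "0 < t" "t < m" for t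
    by (rule DERIV_positive_right[where f = w and f' = w1 and m = m and t = t]) (use z d0 m pos1 that in auto)
  let ?P = "\<lambda>t. 2 * w t * w2 t - (w1 t)\<^sup>2"
  have dP: "(?P has_real_derivative 2 * w t * w3 t) (at t)" if "\<bar>t\<bar> < m" for t
    using d0[of t] d1[of t] d2[of t] m(2)[OF that]
    by (auto intro!: derivative_eq_intros simp: algebra_simps)
  have dP_pos: "2 * w t * w3 t > 0" if "0 < t" "t < m" for t
    using pos0[OF that] w3_pos[OF that] by simp
  have "?P t > 0" if "0 < t" "t < m" for t
    by (rule DERIV_positive_right[where f = ?P and f' = "\<lambda>t. 2 * w t * w3 t"
          and m = m and t = t]) (use z dP dP_pos that in auto)
  with pos0 m(1) show ?thesis
    unfolding eventually_at_right_field by (intro exI[of _ m]) auto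
qed

lemma DERIV_inverse_sqrt:
  fixes R :: "real \<Rightarrow> real"
  assumes "R t > 0" and "(R has_real_derivative R1) (at t)"
  shows "((\<lambda>t. 1 / sqrt (R t)) has_real_derivative - R1 * (1 / sqrt (R t)) ^ 3 / 2) (at t)"
proof -
  have "sqrt (R t) > 0"
    using assms(1) by auto
  then show ?thesis
    using assms
    by (auto intro!: derivative_eq_intros simp: field_simps power3_eq_cube power2_eq_square)
qed

section \<open>The kinetic function and the Lagrange point\<close>

text \<open>The function W: \<open>regularized_hamiltonian\<close> is
  \<open>(norm u)\<^sup>2 / 2\<close> minus it, so the energy surface lies over the region where it
  is nonnegative.\<close>

definition regularized_kinetic :: "real \<Rightarrow> real \<Rightarrow> complex \<Rightarrow> real" where
  "regularized_kinetic \<mu> c v =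
     (1 - \<mu>) / 2 + c * (norm v)\<^sup>2 + \<mu> * ((norm v)\<^sup>2 / norm (2 * v\<^sup>2 - 1))"

lemma mem_regularized_energy_surface:
  "(v, u) \<in> regularized_energy_surface \<mu> c \<longleftrightarrow>
     2 * v\<^sup>2 \<noteq> 1 \<and> (norm u)\<^sup>2 = 2 * regularized_kinetic \<mu> c v"
  unfolding regularized_energy_surface_def regularized_hamiltonian_def regularized_kinetic_def
    norm_levi_civita_moon[symmetric]
  by (auto simp: moon_def field_simps)

text \<open>Writing L for this position on the axis, the attractions balance there:
  \<open>(1 - \<mu>) / L\<^sup>2 = \<mu> / (1 - L)\<^sup>2\<close>. It is measured in the physical
  plane; the circle through it is \<open>2 * (norm v)\<^sup>2 = L\<close>.\<close>

definition lagrange_point :: "real \<Rightarrow> real" where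
  "lagrange_point \<mu> = sqrt (1 - \<mu>) / (sqrt \<mu> + sqrt (1 - \<mu>))"

text \<open>The critical energy is minus the square of \<open>sqrt \<mu> + sqrt (1 - \<mu>)\<close>,
  the denominator of the Lagrange point. The last two identities serve to eliminate
  \<open>\<mu>\<close> later.\<close>

lemma lagrange_point:
  assumes "0 < \<mu>" "\<mu> < 1"
  shows "0 < lagrange_point \<mu>" "lagrange_point \<mu> < 1"
    and "critical_energy \<mu> < 0"
    and "1 - \<mu> = - critical_energy \<mu> * (lagrange_point \<mu>)\<^sup>2"
    and "\<mu> = - critical_energy \<mu> * (1 - lagrange_point \<mu>)\<^sup>2"
proof -
  define a b where "a = sqrt \<mu>" and "b = sqrt (1 - \<mu>)"
  have ab: "a > 0" "b > 0" "a\<^sup>2 = \<mu>" "b\<^sup>2 = 1 - \<mu>"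
    using assms by (auto simp: a_def b_def)
  have c: "critical_energy \<mu> = - (a + b)\<^sup>2"
    using ab unfolding critical_energy_def real_sqrt_mult a_def[symmetric] b_def[symmetric]
    by (simp add: power2_sum)
  have l: "lagrange_point \<mu> = b / (a + b)" and l': "1 - lagrange_point \<mu> = a / (a + b)"
    using ab by (auto simp: lagrange_point_def a_def[symmetric] b_def[symmetric] field_simps)
  show "0 < lagrange_point \<mu>" "lagrange_point \<mu> < 1"
    using ab l by auto
  have "(a + b)\<^sup>2 > 0" using ab by simp
  then show "critical_energy \<mu> < 0"
    "1 - \<mu> = - critical_energy \<mu> * (lagrange_point \<mu>)\<^sup>2"
    "\<mu> = - critical_energy \<mu> * (1 - lagrange_point \<mu>)\<^sup>2"
    using ab unfolding c l' unfolding l by (auto simp: power_divide)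
qed

lemma one_minus_norm_le: "1 - 2 * (norm v)\<^sup>2 \<le> norm (2 * v\<^sup>2 - (1 :: complex))"
  using norm_triangle_ineq2[of 1 "2 * v\<^sup>2"]
  by (simp add: norm_mult norm_power norm_minus_commute)

text \<open>
  \<open>regularized_kinetic \<mu> c v / (norm v)\<^sup>2\<close> is nonincreasing along rays from the Earth up to the distance of
  the Lagrange point, where the attractions of the two primaries along the axis balance.
\<close>
lemma regularized_kinetic_scale_nonneg:
  assumes \<mu>: "0 < \<mu>" "\<mu> < 1" and v: "2 * (norm v)\<^sup>2 \<le> lagrange_point \<mu>"
    and nonneg: "regularized_kinetic \<mu> c v \<ge> 0" and t: "0 \<le> t" "t \<le> 1"
  shows "regularized_kinetic \<mu> c (complex_of_real t * v) \<ge> 0"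
proof (cases "t = 0 \<or> v = 0")
  case True
  then show ?thesis
    using \<mu> by (auto simp: regularized_kinetic_def)
next
  case False
  define n where "n = (norm v)\<^sup>2"
  define l where "l = t\<^sup>2"
  define A where "A = norm (2 * v\<^sup>2 - (1 :: complex))"
  define B where "B = norm (2 * (complex_of_real t * v)\<^sup>2 - 1)"
  define L where "L = lagrange_point \<mu>"
  note L = lagrange_point[OF \<mu>, folded L_def]
  have n: "n > 0" "2 * n \<le> L"
    using False v by (auto simp: n_def L_def)
  have l: "0 < l" "l \<le> 1"
    using False t by (auto simp: l_def power_le_one)
  have nt: "(norm (complex_of_real t * v))\<^sup>2 = l * n"
    by (simp add: norm_mult power_mult_distrib l_def n_def)
  have A: "A \<ge> 1 - L"
    using one_minus_norm_le[of v] n by (simp add: A_def n_def)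
  have "l * n \<le> n"
    using l n by (simp add: mult_left_le_one_le)
  then have B: "B \<ge> 1 - L"
    using one_minus_norm_le[of "complex_of_real t * v"] n unfolding nt B_def by linarith
  have "B - A \<le> norm ((2 * (complex_of_real t * v)\<^sup>2 - 1) - (2 * v\<^sup>2 - 1))"
    unfolding A_def B_def by (rule norm_triangle_ineq2)
  also have "\<dots> = norm (complex_of_real (- 2 * (1 - l)) * v\<^sup>2)"
    by (rule arg_cong[where f = norm]) (simp add: l_def algebra_simps power_mult_distrib)
  also have "\<dots> = 2 * (1 - l) * n"
    using l unfolding norm_mult norm_power n_def norm_of_real by simp
  finally have BA: "B - A \<le> 2 * (1 - l) * n" .
  define C where "C = - critical_energy \<mu>"
  have C: "C > 0" "1 - \<mu> = C * L\<^sup>2" "\<mu> = C * (1 - L)\<^sup>2"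
    using L by (auto simp: C_def)
  have "\<mu> * (1 / A - 1 / B) = C * (1 - L)\<^sup>2 * ((B - A) / (A * B))"
    using A B L C by (simp add: field_simps)
  \<comment> \<open>Both distances to the moon are at least \<open>1 - L\<close>, so its potential
    changes by at most the displacement times its attraction \<open>C\<close> at the Lagrange
    point.\<close>
  also have "\<dots> \<le> C * (1 - L)\<^sup>2 * (2 * (1 - l) * n / ((1 - L) * (1 - L)))"
    using A B L C l n BA
    by (intro mult_left_mono order_trans[OF divide_right_mono[OF BA] divide_left_mono] mult_mono)
      auto
  also have "\<dots> = C * (2 * (1 - l) * n)"
    using L by (simp add: power2_eq_square)
  \<comment> \<open>The right side is the change of the Earth's potential between the distances
    \<open>2 * n\<close> and \<open>2 * l * n\<close>. Both are at most \<open>L\<close>, so it is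
    at least \<open>C\<close> times the displacement.\<close>
  also have "\<dots> \<le> (1 - \<mu>) / 2 * ((1 - l) / (l * n))"
  proof -
    have "(2 * n) * (2 * n) \<le> L * L"
      using n by (intro mult_mono) auto
    moreover have "l * (n * n) \<le> n * n"
      using l by (intro mult_left_le_one_le) auto
    ultimately have "4 * (l * n * n) \<le> L\<^sup>2"
      by (simp add: power2_eq_square mult.assoc)
    then have "C * (1 - l) * (4 * (l * n * n)) \<le> C * (1 - l) * L\<^sup>2"
      using C l by (intro mult_left_mono) auto
    then show ?thesis
      using n l unfolding C(2) by (simp add: field_simps)
  qed
  finally have "\<mu> * (1 / A - 1 / B) \<le> (1 - \<mu>) / 2 * ((1 - l) / (l * n))" .
  then have "l * n * (\<mu> * (1 / A - 1 / B)) \<le> l * n * ((1 - \<mu>) / 2 * ((1 - l) / (l * n)))"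
    using l n by (intro mult_left_mono) auto
  also have "\<dots> = (1 - \<mu>) / 2 * (1 - l)"
    using l n by simp
  finally have "l * n * (\<mu> * (1 / A - 1 / B)) \<le> (1 - \<mu>) / 2 * (1 - l)" .
  \<comment> \<open>Subtracting \<open>l\<close> times the value at \<open>v\<close> cancels the
    energy term.\<close>
  moreover have "regularized_kinetic \<mu> c (complex_of_real t * v) =
      l * regularized_kinetic \<mu> c v + ((1 - \<mu>) / 2 * (1 - l) - l * n * (\<mu> * (1 / A - 1 / B)))"
    unfolding regularized_kinetic_def nt n_def[symmetric] A_def[symmetric] B_def[symmetric]
    by (simp add: diff_divide_distrib right_diff_distrib left_diff_distrib distrib_left distrib_right)
  ultimately show ?thesis
    using l nonneg by simp
qed

lemma continuous_on_regularized_kinetic [continuous_intros]: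
  assumes "continuous_on S f" and "\<And>x. x \<in> S \<Longrightarrow> 2 * (f x)\<^sup>2 \<noteq> 1"
  shows "continuous_on S (\<lambda>x. regularized_kinetic \<mu> c (f x))"
  unfolding regularized_kinetic_def by (intro continuous_intros assms) (use assms in auto)

lemma collision_free:
  assumes "2 * (norm v)\<^sup>2 < 1"
  shows "2 * v\<^sup>2 \<noteq> (1 :: complex)"
  using one_minus_norm_le[of v] assms by auto

section \<open>Identification of the Earth component\<close>

text \<open>Explicit candidate for the Earth component, which is defined only by a description
  operator. For \<open>0 < \<mu> < 1\<close> the disc contains no collision with the moon.\<close>

definition inner_surface :: "real \<Rightarrow> real \<Rightarrow> (complex \<times> complex) set" where
  "inner_surface \<mu> c =
     {(v, u). 2 * (norm v)\<^sup>2 < lagrange_point \<mu> \<and> (norm u)\<^sup>2 = 2 * regularized_kinetic \<mu> c v}"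

lemma inner_surface_subset:
  assumes "0 < \<mu>" "\<mu> < 1"
  shows "inner_surface \<mu> c \<subseteq> regularized_energy_surface \<mu> c"
  using lagrange_point(2)[OF assms]
  by (auto simp: inner_surface_def mem_regularized_energy_surface intro!: collision_free)

text \<open>Shrinking \<open>v\<close> to 0 along its ray, with the direction of \<open>u\<close>
  fixed and its length dictated by the energy, joins every point to the circle over
  \<open>v = 0\<close>.\<close>

lemma connected_inner_surface:
  assumes \<mu>: "0 < \<mu>" "\<mu> < 1"
  shows "connected (inner_surface \<mu> c)"
proof -
  define S where "S = {0 :: complex} \<times> sphere (0 :: complex) (sqrt (1 - \<mu>))"
  have S: "connected S"
    unfolding S_def by (intro connected_Times connected_sphere) auto
  have S_sub: "S \<subseteq> inner_surface \<mu> c"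
    using \<mu> lagrange_point(1)[OF \<mu>] by (auto simp: S_def inner_surface_def regularized_kinetic_def)
  have "\<exists>T. connected T \<and> p \<in> T \<and> T \<subseteq> inner_surface \<mu> c \<and> T \<inter> S \<noteq> {}"
    if p: "p \<in> inner_surface \<mu> c" for p
  proof -
    obtain v u where vu: "p = (v, u)" by (cases p)
    have v: "2 * (norm v)\<^sup>2 < lagrange_point \<mu>" and u: "(norm u)\<^sup>2 = 2 * regularized_kinetic \<mu> c v"
      using p by (auto simp: inner_surface_def vu)
    have hv: "regularized_kinetic \<mu> c v \<ge> 0"
      using u zero_le_power2[of "norm u"] by linarith
    \<comment> \<open>At \<open>u = 0\<close> any direction will do; the default 1 keeps
      \<open>w\<close> a unit vector.\<close>
    define w where "w = (if u = 0 then 1 else sgn u)"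
    have w: "norm w = 1" "u = complex_of_real (norm u) * w"
      by (auto simp: w_def norm_sgn sgn_eq norm_divide)
    define f where "f = (\<lambda>t. (complex_of_real t * v,
      complex_of_real (sqrt (2 * regularized_kinetic \<mu> c (complex_of_real t * v))) * w))"
    have small: "2 * (norm (complex_of_real t * v))\<^sup>2 < lagrange_point \<mu>" if "t \<in> {0..1}" for t
    proof -
      have "(norm (complex_of_real t * v))\<^sup>2 \<le> (norm v)\<^sup>2"
        unfolding norm_mult using that by (intro power_mono) (auto intro!: mult_left_le_one_le)
      then show ?thesis using v by linarith
    qed
    have "connected (f ` {0..1})"
    proof (intro connected_continuous_image)
      show "continuous_on {0..1} f"
        unfolding f_def using small lagrange_point(2)[OF \<mu>]
        by (intro continuous_intros collision_free) (auto intro: less_trans)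
    qed auto
    moreover have "p = f 1"
      using w u hv by (simp add: f_def vu flip: u)
    moreover have "f ` {0..1} \<subseteq> inner_surface \<mu> c"
      using small regularized_kinetic_scale_nonneg[OF \<mu> less_imp_le[OF v] hv] w
      by (auto simp: f_def inner_surface_def norm_mult)
    moreover have "f 0 \<in> S"
      using w \<mu> by (simp add: f_def S_def regularized_kinetic_def norm_mult)
    ultimately show ?thesis
      by (intro exI[of _ "f ` {0..1}"]) force
  qed
  then obtain T where T: "\<And>p. p \<in> inner_surface \<mu> c \<Longrightarrow>
      connected (T p) \<and> p \<in> T p \<and> T p \<subseteq> inner_surface \<mu> c \<and> T p \<inter> S \<noteq> {}"
    by metis
  have "inner_surface \<mu> c = (\<Union>p\<in>inner_surface \<mu> c. S \<union> T p)"
    using S_sub T by fastforce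
  moreover have "connected (\<Union>p\<in>inner_surface \<mu> c. S \<union> T p)"
  proof (rule connected_Union)
    show "\<Inter>((\<lambda>p. S \<union> T p) ` inner_surface \<mu> c) \<noteq> {}"
    proof -
      have "(0, complex_of_real (sqrt (1 - \<mu>))) \<in> S" using \<mu> by (simp add: S_def)
      then show ?thesis by blast
    qed
  qed (use S T in \<open>auto intro!: connected_Un\<close>)
  ultimately show ?thesis by simp
qed

text \<open>On this circle the moon is nearest at the Lagrange point. Bounding its distance by
  \<open>1 - L\<close> leaves the upper bound \<open>(c + C) * (L / 2)\<close>, which vanishes at
  the critical energy.\<close>

lemma regularized_kinetic_barrier:
  assumes \<mu>: "0 < \<mu>" "\<mu> < 1" and c: "c < critical_energy \<mu>"
    and v: "2 * (norm v)\<^sup>2 = lagrange_point \<mu>"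
  shows "regularized_kinetic \<mu> c v < 0"
proof -
  define L where "L = lagrange_point \<mu>"
  define C where "C = - critical_energy \<mu>"
  have L: "0 < L" "L < 1" and C: "C > 0" "1 - \<mu> = C * L\<^sup>2" "\<mu> = C * (1 - L)\<^sup>2"
    using lagrange_point[OF \<mu>] by (auto simp: L_def C_def)
  have n: "(norm v)\<^sup>2 = L / 2"
    using v by (simp add: L_def)
  have A: "1 - L \<le> norm (2 * v\<^sup>2 - (1 :: complex))"
    using one_minus_norm_le[of v] n by simp
  have "\<mu> * (L / 2 / norm (2 * v\<^sup>2 - (1 :: complex))) \<le> \<mu> * (L / 2 / (1 - L))"
    using \<mu> A L by (intro mult_left_mono divide_left_mono mult_pos_pos) auto
  also have "\<dots> = C * (1 - L) * L / 2"
    using L unfolding C(3) by (simp add: field_simps power2_eq_square)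
  finally have "regularized_kinetic \<mu> c v \<le> (1 - \<mu>) / 2 + c * (L / 2) + C * (1 - L) * L / 2"
    unfolding regularized_kinetic_def n by simp
  also have "\<dots> = (c + C) * (L / 2)"
    unfolding C(2) by (simp add: field_simps power2_eq_square)
  also have "\<dots> < 0"
    using c L by (intro mult_neg_pos) (auto simp: C_def)
  finally show ?thesis .
qed

text \<open>By the barrier the strict bound on \<open>v\<close> may be relaxed to a closed one, and
  the energy equation bounds \<open>u\<close>.\<close>

lemma compact_inner_surface:
  assumes \<mu>: "0 < \<mu>" "\<mu> < 1" and c: "c < critical_energy \<mu>"
  shows "compact (inner_surface \<mu> c)"
proof -
  define D where "D = {v :: complex. 2 * (norm v)\<^sup>2 \<le> lagrange_point \<mu>}"
  have bD: "norm v \<le> 1" if "v \<in> D" for v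
    using that lagrange_point(2)[OF \<mu>] by (simp add: D_def power2_le_imp_le[of "norm v" 1])
  have "closed D"
    unfolding D_def by (intro closed_Collect_le continuous_intros)
  moreover have "bounded D"
    using bD by (auto simp: bounded_iff)
  ultimately have D: "compact D"
    by (simp add: compact_eq_bounded_closed)
  have cont: "continuous_on D (\<lambda>v. 2 * regularized_kinetic \<mu> c v)"
    using lagrange_point(2)[OF \<mu>]
    by (intro continuous_intros collision_free) (auto simp: D_def)
  have "bounded ((\<lambda>v. 2 * regularized_kinetic \<mu> c v) ` D)"
    using compact_continuous_image[OF cont D] by (rule compact_imp_bounded)
  then obtain B where B: "\<And>v. v \<in> D \<Longrightarrow> \<bar>2 * regularized_kinetic \<mu> c v\<bar> \<le> B"
    by (auto simp: bounded_iff)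
  define E where "E = D \<times> cball (0 :: complex) (sqrt B)"
  have E: "compact E"
    unfolding E_def by (intro compact_Times D compact_cball)
  have contE: "continuous_on E (\<lambda>p. (norm (snd p))\<^sup>2 - 2 * regularized_kinetic \<mu> c (fst p))"
    using lagrange_point(2)[OF \<mu>]
    by (intro continuous_intros collision_free) (auto simp: E_def D_def)
  have "inner_surface \<mu> c = {p \<in> E. (norm (snd p))\<^sup>2 - 2 * regularized_kinetic \<mu> c (fst p) = 0}"
    (is "_ = ?F")
  proof (intro equalityI subsetI)
    fix p assume p: "p \<in> inner_surface \<mu> c"
    then have "fst p \<in> D" "(norm (snd p))\<^sup>2 = 2 * regularized_kinetic \<mu> c (fst p)"
      by (auto simp: inner_surface_def D_def)
    moreover from this B[of "fst p"] have "norm (snd p) \<le> sqrt B"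
      by (intro real_le_rsqrt) auto
    ultimately show "p \<in> ?F"
      by (cases p) (auto simp: E_def)
  next
    fix p assume p: "p \<in> ?F"
    then have "2 * (norm (fst p))\<^sup>2 \<noteq> lagrange_point \<mu>"
      using regularized_kinetic_barrier[OF \<mu> c, of "fst p"] zero_le_power2[of "norm (snd p)"]
      by auto
    with p show "p \<in> inner_surface \<mu> c"
      by (cases p) (auto simp: E_def D_def inner_surface_def)
  qed
  moreover have "compact (E \<inter> ?F)"
    by (intro compact_Int_closed E
        continuous_closed_preimage_constant[OF contE compact_imp_closed[OF E]])
  moreover have "E \<inter> ?F = ?F" by auto
  ultimately show ?thesis by argo
qed

text \<open>The strict bound on \<open>v\<close> makes the inner surface relatively open, and
  compactness makes it closed; being connected, it is a component. It contains every surface point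
  over \<open>v = 0\<close>, which gives uniqueness.\<close>

lemma regularized_earth_component_eq:
  assumes \<mu>: "0 < \<mu>" "\<mu> < 1" and c: "c < critical_energy \<mu>"
  shows "regularized_earth_component \<mu> c = inner_surface \<mu> c"
proof -
  let ?S = "regularized_energy_surface \<mu> c" and ?I = "inner_surface \<mu> c"
  let ?p = "(0 :: complex, complex_of_real (sqrt (1 - \<mu>)))"
  have p: "?p \<in> ?I"
    using \<mu> lagrange_point(1)[OF \<mu>] by (simp add: inner_surface_def regularized_kinetic_def)
  have over_0: "q \<in> ?I" if "q \<in> ?S" "fst q = 0" for q
    using that lagrange_point(1)[OF \<mu>]
    by (cases q) (auto simp: inner_surface_def mem_regularized_energy_surface)
  have "?I = ?S \<inter> {p. 2 * (norm (fst p))\<^sup>2 < lagrange_point \<mu>}"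
    using inner_surface_subset[OF \<mu>, of c]
    by (auto simp: inner_surface_def mem_regularized_energy_surface)
  moreover have "open {p :: complex \<times> complex. 2 * (norm (fst p))\<^sup>2 < lagrange_point \<mu>}"
    by (intro open_Collect_less continuous_intros)
  ultimately have op: "openin (top_of_set ?S) ?I"
    by (auto simp: openin_open)
  have cl: "closedin (top_of_set ?S) ?I"
    using compact_inner_surface[OF assms] inner_surface_subset[OF \<mu>]
    by (simp add: closed_subset compact_imp_closed)
  have maximal: "T \<subseteq> ?I" if "connected T" "T \<subseteq> ?S" "T \<inter> ?I \<noteq> {}" for T
  proof -
    have "openin (top_of_set T) (T \<inter> ?I)" "closedin (top_of_set T) (T \<inter> ?I)"
      using \<open>T \<subseteq> ?S\<close> op cl by (auto simp: openin_open closedin_closed)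
    with that show ?thesis
      using connected_clopen[of T] by blast
  qed
  have comp: "?I \<in> components ?S"
    unfolding in_components_maximal
    using p inner_surface_subset[OF \<mu>] connected_inner_surface[OF \<mu>] maximal by blast
  show ?thesis
    unfolding regularized_earth_component_def
  proof (rule the_equality)
    show "?I \<in> components ?S \<and> compact ?I \<and> 0 \<in> fst ` ?I"
      using comp compact_inner_surface[OF assms] p by force
  next
    fix T assume T: "T \<in> components ?S \<and> compact T \<and> 0 \<in> fst ` T"
    then obtain q where "q \<in> T" "fst q = 0" by auto
    with T have "q \<in> T \<inter> ?I"
      using over_0 in_components_subset by blast
    with T comp show "T = ?I"
      using components_nonoverlap by fastforce
  qed
qed

section \<open>A criterion for non-convexity\<close>

text \<open>Two curves pass through the point \<open>y\<close> with real positive \<open>u\<close>;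
  their accelerations are a positive and a negative multiple of the real direction of
  \<open>u\<close>. Strict convexity would force both signs on
  \<open>Re (snd (\<nu> y))\<close>.\<close>

lemma not_strictly_convex_if_not_concave:
  fixes p q :: complex and h1 :: "real \<Rightarrow> real"
  assumes \<mu>: "0 < \<mu>" "\<mu> < 1" and c: "c < critical_energy \<mu>"
    and q: "q \<noteq> 0" and e: "e > 0"
  defines "h \<equiv> \<lambda>t. regularized_kinetic \<mu> c (p + complex_of_real t * q)"
  assumes small: "2 * (norm (p + complex_of_real a * q))\<^sup>2 < lagrange_point \<mu>"
    and d1: "\<And>t. \<bar>t - a\<bar> < e \<Longrightarrow> (h has_real_derivative h1 t) (at t)"
    and d2: "(h1 has_real_derivative h2) (at a)"
    and pos: "h a > 0" and nonconcave: "2 * h a * h2 > (h1 a)\<^sup>2"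
  shows "\<not> strictly_convex_hypersurface (regularized_earth_component \<mu> c)"
proof
  assume "strictly_convex_hypersurface (regularized_earth_component \<mu> c)"
  then obtain \<nu> where \<nu>: "unit_normal_field (inner_surface \<mu> c) \<nu>"
    and II: "\<And>y X. y \<in> inner_surface \<mu> c \<Longrightarrow> X \<in> tangent_vectors (inner_surface \<mu> c) y \<Longrightarrow>
      X \<noteq> 0 \<Longrightarrow> second_fundamental_form (inner_surface \<mu> c) \<nu> y X X > 0"
    unfolding strictly_convex_hypersurface_def regularized_earth_component_eq[OF \<mu> c] by metis
  define v where "v = (\<lambda>t. p + complex_of_real t * q)"
  define f where "f = (\<lambda>t. sqrt (2 * h t))"
  \<comment> \<open>\<open>f1\<close> and \<open>f2\<close> keep the form that
    \<open>second_derivative_sqrt\<close> gives for \<open>2 * h\<close>.\<close>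
  define f1 where "f1 = (\<lambda>t. 2 * h1 t / (2 * sqrt (2 * h t)))"
  define f2 where "f2 = (2 * (2 * h a) * (2 * h2) - (2 * h1 a)\<^sup>2) / (4 * (2 * h a) * sqrt (2 * h a))"
  have f2: "f2 > 0"
    unfolding f2_def using pos nonconcave by (intro divide_pos_pos) (auto simp: power_mult_distrib mult_ac)
  have fa: "f a > 0"
    using pos by (simp add: f_def)
  have "isCont h a"
    using d1[of a] e by (auto intro: DERIV_isCont)
  then have "(h \<longlongrightarrow> h a) (nhds a)"
    unfolding isCont_def tendsto_at_iff_tendsto_nhds .
  then have "\<forall>\<^sub>F t in nhds a. h t > 0"
    using pos by (rule order_tendstoD)
  moreover have "isCont (\<lambda>t. 2 * (norm (v t))\<^sup>2) a"
    unfolding v_def by (intro continuous_intros)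
  then have "((\<lambda>t. 2 * (norm (v t))\<^sup>2) \<longlongrightarrow> 2 * (norm (v a))\<^sup>2) (nhds a)"
    using tendsto_at_iff_tendsto_nhds[of "\<lambda>t. 2 * (norm (v t))\<^sup>2" a] by (simp add: isCont_def)
  then have "\<forall>\<^sub>F t in nhds a. 2 * (norm (v t))\<^sup>2 < lagrange_point \<mu>"
    using small unfolding v_def by (rule order_tendstoD)
  ultimately have "\<forall>\<^sub>F t in nhds a. h t > 0 \<and> 2 * (norm (v t))\<^sup>2 < lagrange_point \<mu>"
    by (rule eventually_conj)
  then obtain e' where "e' > 0" and
    e': "\<And>t. \<bar>t - a\<bar> < e' \<Longrightarrow> h t > 0 \<and> 2 * (norm (v t))\<^sup>2 < lagrange_point \<mu>"
    unfolding eventually_nhds_metric dist_real_def by blast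
  define r where "r = min e e'"
  have r: "r > 0" "\<And>t. \<bar>t - a\<bar> < r \<Longrightarrow> \<bar>t - a\<bar> < e \<and> h t > 0 \<and> 2 * (norm (v t))\<^sup>2 < lagrange_point \<mu>"
    using e \<open>e' > 0\<close> e' by (auto simp: r_def)
  define y where "y = (v a, complex_of_real (f a))"
  have on_surface: "(v t, u) \<in> inner_surface \<mu> c" if "\<bar>t - a\<bar> < r" "norm u = f t" for t u
    using r(2)[OF that(1)] that(2) by (simp add: inner_surface_def f_def v_def h_def)
  have y: "y \<in> inner_surface \<mu> c"
    unfolding y_def using r(1) fa by (intro on_surface) auto

  let ?\<gamma> = "\<lambda>t. (v t, complex_of_real (f t))"
  have f_d1: "(f has_real_derivative f1 t) (at t)" if "\<bar>t - a\<bar> < r" for t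
    unfolding f_def f1_def using r(2)[OF that] d1[of t]
    by (auto intro!: derivative_eq_intros simp: field_simps)
  have "(f1 has_real_derivative f2) (at a)"
    unfolding f1_def f2_def using pos d1[of a] d2 e
    by (intro second_derivative_sqrt) (auto intro!: derivative_eq_intros)
  then have f1_d: "((\<lambda>t. (q, complex_of_real (f1 t))) has_vector_derivative (0, complex_of_real f2)) (at a)"
    by (intro has_vector_derivative_Pair has_vector_derivative_const has_vector_derivative_of_real)
      (simp add: has_real_derivative_iff_has_vector_derivative)
  have f_d: "(?\<gamma> has_vector_derivative (q, complex_of_real (f1 t))) (at t)" if "\<bar>t - a\<bar> < r" for t
  proof (intro has_vector_derivative_Pair has_vector_derivative_of_real)
    show "(v has_vector_derivative q) (at t)"
      unfolding v_def by (auto intro!: derivative_eq_intros)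
  qed (use f_d1[OF that] in \<open>simp add: has_real_derivative_iff_has_vector_derivative\<close>)
  have "?\<gamma> t \<in> inner_surface \<mu> c" if "\<bar>t - a\<bar> < r" for t
    using that r(2)[OF that] by (intro on_surface) (auto simp: f_def)
  then have radial:
    "(q, complex_of_real (f1 a)) \<in> tangent_vectors (inner_surface \<mu> c) y"
    "second_fundamental_form (inner_surface \<mu> c) \<nu> y (q, complex_of_real (f1 a))
       (q, complex_of_real (f1 a)) = \<nu> y \<bullet> (0, complex_of_real f2)"
    unfolding y_def
    using second_fundamental_form_curve[where \<gamma> = ?\<gamma> and ?\<gamma>1.0 = "\<lambda>t. (q, complex_of_real (f1 t))"
        and a = a and e = r, OF \<nu> r(1) _ f_d f1_d] by blast+
  have "0 < \<nu> y \<bullet> (0, complex_of_real f2)"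
    unfolding radial(2)[symmetric] using q by (intro II y radial(1)) (auto simp: zero_prod_def)
  then have nu_pos: "Re (snd (\<nu> y)) > 0"
    using f2 by (simp add: inner_prod_def inner_complex_def zero_less_mult_iff)
  \<comment> \<open>Rotating \<open>u\<close> over a fixed \<open>v\<close> preserves the
    energy.\<close>
  let ?\<rho> = "\<lambda>t. (v a, complex_of_real (f a) * cis t)"
  let ?\<rho>1 = "\<lambda>t. (0 :: complex, complex_of_real (f a) * (\<i> * cis t))"
  have "(?\<rho> has_vector_derivative ?\<rho>1 t) (at t)" for t
    by (intro has_vector_derivative_Pair)
      (auto intro!: derivative_eq_intros simp: has_vector_derivative_complex_iff)
  moreover have "(?\<rho>1 has_vector_derivative (0, - complex_of_real (f a))) (at 0)"
    by (intro has_vector_derivative_Pair)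
      (auto intro!: derivative_eq_intros simp: has_vector_derivative_complex_iff)
  moreover have "?\<rho> t \<in> inner_surface \<mu> c" for t
    using r(1) fa by (intro on_surface) (auto simp: norm_mult)
  ultimately have rotation:
    "?\<rho>1 0 \<in> tangent_vectors (inner_surface \<mu> c) (?\<rho> 0)"
    "second_fundamental_form (inner_surface \<mu> c) \<nu> (?\<rho> 0) (?\<rho>1 0) (?\<rho>1 0) =
       \<nu> (?\<rho> 0) \<bullet> (0, - complex_of_real (f a))"
    using second_fundamental_form_curve[where \<gamma> = ?\<rho> and ?\<gamma>1.0 = ?\<rho>1 and a = 0 and e = 1, OF \<nu>]
    by auto
  have "?\<rho> 0 = y"
    by (simp add: y_def)
  note rotation = rotation[unfolded this]
  have "0 < \<nu> y \<bullet> (0, - complex_of_real (f a))"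
    unfolding rotation(2)[symmetric] using fa by (intro II y rotation(1)) (auto simp: zero_prod_def)
  then have "Re (snd (\<nu> y)) < 0"
    using fa by (simp add: inner_prod_def inner_complex_def mult_less_0_iff)
  with nu_pos show False by simp
qed

section \<open>The jet of the moon term\<close>

text \<open>Explicit values are needed only at 0, where the line starts on the real axis; elsewhere
  the existence of the derivatives suffices.\<close>

lemma moon_term_jet:
  fixes x b :: real
  assumes x: "2 * x\<^sup>2 < 1"
  defines "v \<equiv> \<lambda>t. complex_of_real x + complex_of_real t * Complex (- 1) b"
  obtains G1 G2 G3 :: "real \<Rightarrow> real" where
    "\<And>t. 2 * (v t)\<^sup>2 \<noteq> 1 \<Longrightarrow>
       ((\<lambda>t. (norm (v t))\<^sup>2 / norm (2 * (v t)\<^sup>2 - 1)) has_real_derivative G1 t) (at t)"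
    "\<And>t. 2 * (v t)\<^sup>2 \<noteq> 1 \<Longrightarrow> (G1 has_real_derivative G2 t) (at t)"
    "\<And>t. 2 * (v t)\<^sup>2 \<noteq> 1 \<Longrightarrow> (G2 has_real_derivative G3 t) (at t)"
    "isCont G3 0"
    "G1 0 = - 2 * x / (1 - 2 * x\<^sup>2)\<^sup>2"
    "G2 0 = 2 * (6 * x\<^sup>2 * (1 - b\<^sup>2) + (1 + b\<^sup>2)) / (1 - 2 * x\<^sup>2) ^ 3"
    "G3 0 = 12 * x * ((1 + 8 * x\<^sup>2) * (3 * b\<^sup>2 - 1) - 3 * (1 + b\<^sup>2)) / (1 - 2 * x\<^sup>2) ^ 4"
proof -
  \<comment> \<open>\<open>N\<close> is the squared norm of \<open>v t\<close>, \<open>R\<close> the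
    squared distance to the moon, and \<open>h\<close> its inverse square root, so the moon term is
    \<open>N * h\<close>.\<close>
  define N where "N = (\<lambda>t. (x - t)\<^sup>2 + b\<^sup>2 * t\<^sup>2)"
  define N1 where "N1 = (\<lambda>t. - 2 * (x - t) + 2 * b\<^sup>2 * t)"
  define N2 where "N2 = 2 * (1 + b\<^sup>2)"
  define R where "R = (\<lambda>t. 1 - 4 * ((x - t)\<^sup>2 - b\<^sup>2 * t\<^sup>2) + 4 * (N t)\<^sup>2)"
  define R1 where "R1 = (\<lambda>t. 8 * (x - t) + 8 * b\<^sup>2 * t + 8 * N t * N1 t)"
  define R2 where "R2 = (\<lambda>t. - 8 + 8 * b\<^sup>2 + 8 * (N1 t)\<^sup>2 + 8 * N t * N2)"
  define R3 where "R3 = (\<lambda>t. 24 * N1 t * N2)"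
  define h where "h = (\<lambda>t. 1 / sqrt (R t))"
  define h1 where "h1 = (\<lambda>t. - R1 t * h t ^ 3 / 2)"
  define h2 where "h2 = (\<lambda>t. - R2 t * h t ^ 3 / 2 + 3 / 4 * (R1 t)\<^sup>2 * h t ^ 5)"
  define h3 where "h3 = (\<lambda>t. - R3 t * h t ^ 3 / 2 + 9 / 4 * R1 t * R2 t * h t ^ 5
    - 15 / 8 * R1 t ^ 3 * h t ^ 7)"
  have norm_v: "(norm (v t))\<^sup>2 = N t" for t
    by (simp add: v_def N_def cmod_power2 power_mult_distrib mult.commute)
  have norm_moon: "norm (2 * (v t)\<^sup>2 - 1) = sqrt (R t)" for t
    unfolding cmod_def v_def R_def N_def
    by (rule arg_cong[where f = sqrt]) (simp add: power2_eq_square algebra_simps)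
  have R_pos: "R t > 0" if "2 * (v t)\<^sup>2 \<noteq> 1" for t
    using that norm_moon[of t] real_sqrt_gt_zero[of "R t"]
    by (metis norm_le_zero_iff not_le real_sqrt_le_0_iff eq_iff_diff_eq_0)
  have dN: "(N has_real_derivative N1 t) (at t)" "(N1 has_real_derivative N2) (at t)" for t
    unfolding N_def N1_def N2_def
    by (auto intro!: derivative_eq_intros simp: algebra_simps)
  have dR: "(R has_real_derivative R1 t) (at t)" "(R1 has_real_derivative R2 t) (at t)"
    "(R2 has_real_derivative R3 t) (at t)" for t
    unfolding R_def R1_def R2_def R3_def
    by (auto intro!: derivative_eq_intros dN simp: algebra_simps power2_eq_square)
  have dh: "(h has_real_derivative h1 t) (at t)" if "R t > 0" for t
    unfolding h1_def h_def by (rule DERIV_inverse_sqrt[OF that dR(1)])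
  have dh1: "(h1 has_real_derivative h2 t) (at t)" if "R t > 0" for t
    unfolding h1_def
    by (rule derivative_eq_intros dR dh that numeral_neq_zero refl)+
      (simp_all add: h1_def h2_def, algebra)
  have dh2: "(h2 has_real_derivative h3 t) (at t)" if "R t > 0" for t
    unfolding h2_def
    by (rule derivative_eq_intros dR dh that numeral_neq_zero refl)+
      (simp_all add: h1_def h3_def, algebra)
  \<comment> \<open>Leibniz rule for \<open>N * h\<close>; the third derivative of the quadratic
    \<open>N\<close> is 0.\<close>
  define G1 where "G1 = (\<lambda>t. N1 t * h t + N t * h1 t)"
  define G2 where "G2 = (\<lambda>t. N2 * h t + 2 * N1 t * h1 t + N t * h2 t)"
  define G3 where "G3 = (\<lambda>t. 3 * N2 * h1 t + 3 * N1 t * h2 t + N t * h3 t)"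
  \<comment> \<open>\<open>k\<close> is the distance to the moon at 0; all denominators are powers
    of it.\<close>
  define k where "k = 1 - 2 * x\<^sup>2"
  have k: "k > 0" using x by (simp add: k_def)
  have at_0: "N 0 = x\<^sup>2" "N1 0 = - 2 * x" "R1 0 = 8 * x * k"
    "R2 0 = - 8 + 8 * b\<^sup>2 + 32 * x\<^sup>2 + 16 * x\<^sup>2 * (1 + b\<^sup>2)" "R3 0 = - 96 * x * (1 + b\<^sup>2)"
    by (simp_all add: N_def N1_def N2_def R1_def R2_def R3_def k_def algebra_simps power2_eq_square)
  have R0: "R 0 = k\<^sup>2"
    by (simp add: R_def N_def k_def algebra_simps power2_eq_square)
  then have h0: "h 0 = 1 / k" and "R 0 > 0"
    using k by (simp_all add: h_def)
  show ?thesis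
  proof
    fix t assume "2 * (v t)\<^sup>2 \<noteq> 1"
    note Rt = R_pos[OF this]
    show "((\<lambda>t. (norm (v t))\<^sup>2 / norm (2 * (v t)\<^sup>2 - 1)) has_real_derivative G1 t) (at t)"
      using DERIV_mult[OF dN(1) dh[OF Rt]] unfolding norm_v norm_moon G1_def h_def
      by (simp add: algebra_simps)
    show "(G1 has_real_derivative G2 t) (at t)"
      unfolding G1_def
      by (rule derivative_eq_intros dN dh dh1 Rt refl)+ (simp add: G2_def)
    show "(G2 has_real_derivative G3 t) (at t)"
      unfolding G2_def
      by (rule derivative_eq_intros dN dh dh1 dh2 Rt refl)+ (simp add: G3_def algebra_simps)
  next
    have "isCont N 0" "isCont N1 0" "isCont R1 0" "isCont R2 0" "isCont R3 0" "isCont h 0"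
      using dN[THEN DERIV_isCont] dR[THEN DERIV_isCont] dh[OF \<open>R 0 > 0\<close>, THEN DERIV_isCont]
      by (auto simp: R3_def)
    then show "isCont G3 0"
      unfolding G3_def h1_def h2_def h3_def by (intro continuous_intros) auto
    have h1_0: "h1 0 = - 4 * x / k\<^sup>2"
      unfolding h1_def at_0 h0 using k by (simp add: field_simps eval_nat_numeral)
    define r where "r = R2 0"
    have r: "r = - 8 + 8 * b\<^sup>2 + 32 * x\<^sup>2 + 16 * x\<^sup>2 * (1 + b\<^sup>2)"
      unfolding r_def by (rule at_0)
    have h2_0: "h2 0 = (48 * x\<^sup>2 - r / 2) / k ^ 3"
      unfolding h2_def at_0(3) r_def[symmetric] h0 using k
      by (simp add: field_simps eval_nat_numeral)
    have h3_0: "h3 0 = (48 * x * (1 + b\<^sup>2) * k + 18 * x * r - 960 * x ^ 3) / k ^ 4"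
      unfolding h3_def at_0(3,5) r_def[symmetric] h0 using k
      by (simp add: field_simps eval_nat_numeral)
    have "G1 0 = (- 2 * x * k + x\<^sup>2 * (- 4 * x)) / k\<^sup>2"
      unfolding G1_def at_0(1,2) h1_0 h0 using k
      by (simp add: add_divide_distrib diff_divide_distrib power2_eq_square)
    also have "- 2 * x * k + x\<^sup>2 * (- 4 * x) = - 2 * x"
      unfolding k_def by algebra
    finally show "G1 0 = - 2 * x / (1 - 2 * x\<^sup>2)\<^sup>2"
      unfolding k_def .
    have "G2 0 = (2 * (1 + b\<^sup>2) * k\<^sup>2 + 16 * x\<^sup>2 * k + x\<^sup>2 * (48 * x\<^sup>2 - r / 2)) / k ^ 3"
      unfolding G2_def at_0(1,2) h1_0 h2_0 h0 N2_def using k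
      by (simp add: field_simps eval_nat_numeral)
    also have "2 * (1 + b\<^sup>2) * k\<^sup>2 + 16 * x\<^sup>2 * k + x\<^sup>2 * (48 * x\<^sup>2 - r / 2)
        = 2 * (6 * x\<^sup>2 * (1 - b\<^sup>2) + (1 + b\<^sup>2))"
      unfolding k_def r by (simp add: field_simps power2_eq_square)
    finally show "G2 0 = 2 * (6 * x\<^sup>2 * (1 - b\<^sup>2) + (1 + b\<^sup>2)) / (1 - 2 * x\<^sup>2) ^ 3"
      unfolding k_def .
    have "G3 0 = (- 24 * x * (1 + b\<^sup>2) * k\<^sup>2 - 6 * x * (48 * x\<^sup>2 - r / 2) * k
        + x\<^sup>2 * (48 * x * (1 + b\<^sup>2) * k + 18 * x * r - 960 * x ^ 3)) / k ^ 4"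
      unfolding G3_def at_0(1,2) h1_0 h2_0 h3_0 N2_def using k
      by (simp add: field_simps eval_nat_numeral)
    also have "- 24 * x * (1 + b\<^sup>2) * k\<^sup>2 - 6 * x * (48 * x\<^sup>2 - r / 2) * k
        + x\<^sup>2 * (48 * x * (1 + b\<^sup>2) * k + 18 * x * r - 960 * x ^ 3)
        = 12 * x * ((1 + 8 * x\<^sup>2) * (3 * b\<^sup>2 - 1) - 3 * (1 + b\<^sup>2))"
      unfolding k_def r by (simp add: field_simps eval_nat_numeral)
    finally show "G3 0 = 12 * x * ((1 + 8 * x\<^sup>2) * (3 * b\<^sup>2 - 1) - 3 * (1 + b\<^sup>2)) / (1 - 2 * x\<^sup>2) ^ 4"
      unfolding k_def .
  qed
qed

theorem theorem1p3:
  fixes \<mu> :: real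
  assumes "0 < \<mu>" and "\<mu> < 16 / 17"
  shows "\<exists>\<epsilon>>0. \<forall>c\<in>{critical_energy \<mu> - \<epsilon><..<critical_energy \<mu>}.
           \<not> strictly_convex_hypersurface (regularized_earth_component \<mu> c)"
proof -

  \<comment> \<open>The Lagrange point and a line through it\<close>
  have \<mu>: "0 < \<mu>" "\<mu> < 1" using assms by auto
  define L where "L = lagrange_point \<mu>"
  define c0 where "c0 = critical_energy \<mu>"
  define k where "k = 1 - L"
  have L: "0 < L" "L < 1" and k: "k > 0" "L = 1 - k" and c0: "c0 < 0"
    and \<mu>_eq: "1 - \<mu> = - c0 * L\<^sup>2" "\<mu> = - c0 * k\<^sup>2"
    using lagrange_point[OF \<mu>] by (auto simp: L_def c0_def k_def)
  \<comment> \<open>This is exactly what makes the interval for \<open>\<beta>\<close> below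
    nonempty. Otherwise \<open>16 * L\<^sup>2 \<le> k\<^sup>2\<close>, and multiplying by
    \<open>- c0\<close> contradicts the bound on \<open>\<mu>\<close>.\<close>
  have "1 / 5 < L"
  proof (rule ccontr)
    assume "\<not> 1 / 5 < L"
    then have "L\<^sup>2 \<le> (1 / 5)\<^sup>2" "(4 / 5)\<^sup>2 \<le> k\<^sup>2"
      using L by (auto simp: k_def intro!: power_mono)
    then have "16 * L\<^sup>2 \<le> k\<^sup>2"
      by (simp add: power2_eq_square)
    then have "- c0 * (16 * L\<^sup>2) \<le> - c0 * k\<^sup>2"
      using c0 by (intro mult_left_mono) auto
    then have "16 * (1 - \<mu>) \<le> \<mu>"
      using \<mu>_eq by simp
    with assms show False by simp
  qed
  \<comment> \<open>The positive Levi-Civita preimage of the Lagrange point: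
    \<open>2 * x\<^sup>2 = L\<close>.\<close>
  define x where "x = sqrt (L / 2)"
  have x: "x > 0" "x\<^sup>2 = L / 2"
    using L by (auto simp: x_def)
  have "(1 + L) / (3 * L) < 2"
    using \<open>1 / 5 < L\<close> by (simp add: field_simps)
  (* For the direction -1 + i b with b^2 = \<beta>, the quadratic part of W is positive iff \<beta> < 2 and the
     cubic part is positive iff \<beta> > (1 + L) / (3 L). *)
  then obtain \<beta> where \<beta>: "(1 + L) / (3 * L) < \<beta>" "\<beta> < 2"
    using dense by blast
  have "\<beta> > 0"
    using \<beta>(1) L by (auto intro: less_trans[rotated])
  define b where "b = sqrt \<beta>"
  have b: "b\<^sup>2 = \<beta>"
    using \<open>\<beta> > 0\<close> by (simp add: b_def)
  define q where "q = Complex (- 1) b"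
  define v where "v = (\<lambda>t. complex_of_real x + complex_of_real t * q)"
  define N where "N = (\<lambda>t. (norm (v t))\<^sup>2)"
  define N1 where "N1 = (\<lambda>t. - 2 * x + 2 * (1 + \<beta>) * t)"
  define N2 where "N2 = 2 * (1 + \<beta>)"
  have N: "N t = x\<^sup>2 - 2 * x * t + (1 + \<beta>) * t\<^sup>2" for t
    unfolding N_def v_def q_def cmod_power2 b[symmetric]
    by (simp add: power2_eq_square algebra_simps)
  have dN: "(N has_real_derivative N1 t) (at t)" "(N1 has_real_derivative N2) (at t)" for t
    unfolding N[abs_def] N1_def N2_def by (auto intro!: derivative_eq_intros simp: algebra_simps)
  define G where "G = (\<lambda>t. N t / norm (2 * (v t)\<^sup>2 - 1))"
  have "2 * x\<^sup>2 < 1" using x L by simp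
  then obtain G1 G2 G3 where dG:
      "\<And>t. 2 * (v t)\<^sup>2 \<noteq> 1 \<Longrightarrow> (G has_real_derivative G1 t) (at t)"
      "\<And>t. 2 * (v t)\<^sup>2 \<noteq> 1 \<Longrightarrow> (G1 has_real_derivative G2 t) (at t)"
      "\<And>t. 2 * (v t)\<^sup>2 \<noteq> 1 \<Longrightarrow> (G2 has_real_derivative G3 t) (at t)"
    and "isCont G3 0"
    and G_0: "G1 0 = - 2 * x / (1 - 2 * x\<^sup>2)\<^sup>2"
      "G2 0 = 2 * (6 * x\<^sup>2 * (1 - b\<^sup>2) + (1 + b\<^sup>2)) / (1 - 2 * x\<^sup>2) ^ 3"
      "G3 0 = 12 * x * ((1 + 8 * x\<^sup>2) * (3 * b\<^sup>2 - 1) - 3 * (1 + b\<^sup>2)) / (1 - 2 * x\<^sup>2) ^ 4"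
    by (rule moon_term_jet[of x b, folded q_def, folded v_def[THEN fun_cong],
          folded N_def[THEN fun_cong], folded G_def]) blast
  have G1_0: "G1 0 = - 2 * x / k\<^sup>2"
    and G2_0: "G2 0 = 2 * (3 * L * (1 - \<beta>) + (1 + \<beta>)) / k ^ 3"
    and G3_0: "G3 0 = 12 * x * ((1 + 4 * L) * (3 * \<beta> - 1) - 3 * (1 + \<beta>)) / k ^ 4"
    unfolding G_0 b x(2) k_def by simp_all

  \<comment> \<open>The jet at the critical energy\<close>
  define w where "w = (\<lambda>c t. (1 - \<mu>) / 2 + c * N t + \<mu> * G t)"
  define w1 where "w1 = (\<lambda>c t. c * N1 t + \<mu> * G1 t)"
  define w2 where "w2 = (\<lambda>c t. c * N2 + \<mu> * G2 t)"
  have kinetic: "regularized_kinetic \<mu> c (complex_of_real x + complex_of_real t * q) = w c t" for c t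
    unfolding w_def G_def N_def v_def regularized_kinetic_def by simp
  have dw: "(w c has_real_derivative w1 c t) (at t)" "(w1 c has_real_derivative w2 c t) (at t)"
    "(w2 c has_real_derivative \<mu> * G3 t) (at t)" if "2 * (v t)\<^sup>2 \<noteq> 1" for c t
    using that unfolding w_def w1_def w2_def
    by (auto intro!: derivative_eq_intros dN dG)

  \<comment> \<open>The line meets the circle through the Lagrange point at 0 and again at
    \<open>\<delta>\<close>; in between it runs inside the disc.\<close>
  define \<delta> where "\<delta> = 2 * x / (1 + \<beta>)"
  have "\<delta> > 0" using x \<open>\<beta> > 0\<close> by (simp add: \<delta>_def)
  have small: "2 * N t < L" if "0 < t" "t < \<delta>" for t
  proof -
    have "t * (1 + \<beta>) < 2 * x"
      using that \<open>\<beta> > 0\<close> by (simp add: \<delta>_def field_simps)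
    then have "t * (t * (1 + \<beta>)) < t * (2 * x)"
      using that by (intro mult_strict_left_mono) auto
    then show ?thesis
      unfolding N x(2) by (simp add: power2_eq_square algebra_simps)
  qed
  \<comment> \<open>\<open>positive_jet\<close> needs derivatives on both sides of 0. For negative
    \<open>t\<close> the line leaves the disc, but near 0 it still avoids the moon.\<close>
  have "\<forall>\<^sub>F t in nhds 0. 2 * N t < 1"
  proof (rule order_tendstoD)
    show "((\<lambda>t. 2 * N t) \<longlongrightarrow> 2 * N 0) (nhds 0)"
      unfolding N by (intro tendsto_intros filterlim_ident)
    show "2 * N 0 < 1" using \<open>2 * x\<^sup>2 < 1\<close> by (simp add: N)
  qed
  then obtain \<eta> where "\<eta> > 0" and "\<And>t. \<bar>t\<bar> < \<eta> \<Longrightarrow> 2 * N t < 1"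
    unfolding eventually_nhds_metric dist_real_def by auto
  then have \<eta>: "\<And>t. \<bar>t\<bar> < \<eta> \<Longrightarrow> 2 * (v t)\<^sup>2 \<noteq> 1"
    unfolding N_def by (intro collision_free)
  have "N 0 = L / 2" by (simp add: N x)
  have "2 * (v 0)\<^sup>2 - 1 = complex_of_real (- k)"
    by (simp add: v_def k_def x(2) flip: of_real_power)
  then have "norm (2 * (v 0)\<^sup>2 - 1) = k"
    using k(1) by (simp only: norm_of_real)
  then have "G 0 = L / (2 * k)"
    by (simp add: G_def \<open>N 0 = L / 2\<close>)
  have w_0: "w c0 0 = 0"
    unfolding w_def \<open>N 0 = L / 2\<close> \<open>G 0 = _\<close> \<mu>_eq(1) using k(1)
    by (subst \<mu>_eq(2)) (simp add: k(2) field_simps power2_eq_square)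
  have w1_0: "w1 c0 0 = 0"
    unfolding w1_def G1_0 N1_def using k by (subst \<mu>_eq(2)) simp
  have "w2 c0 0 = - c0 * (2 * (3 * L * (1 - \<beta>) + (1 + \<beta>)) / k - 2 * (1 + \<beta>))"
    unfolding w2_def G2_0 N2_def using k
    by (subst \<mu>_eq(2)) (simp add: field_simps eval_nat_numeral)
  also have "2 * (3 * L * (1 - \<beta>) + (1 + \<beta>)) / k - 2 * (1 + \<beta>) = 4 * L * (2 - \<beta>) / k"
    using k(1) by (simp add: field_simps) (simp add: k_def algebra_simps)
  also have "- c0 * (4 * L * (2 - \<beta>) / k) > 0"
    using c0 L(1) k(1) \<beta>(2) by (intro mult_pos_pos divide_pos_pos) auto
  finally have w2_0: "w2 c0 0 > 0" .
  have "1 + L < \<beta> * (3 * L)"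
    using \<beta>(1) L by (simp add: field_simps)
  then have w3_0: "\<mu> * G3 0 > 0"
    unfolding G3_0 using \<mu> x(1) k(1)
    by (intro mult_pos_pos divide_pos_pos zero_less_power) (auto simp: algebra_simps)
  have "\<forall>\<^sub>F t in at_right 0. w c0 t > 0 \<and> 2 * w c0 t * w2 c0 t > (w1 c0 t)\<^sup>2"
    by (rule positive_jet[OF \<open>\<eta> > 0\<close> dw[OF \<eta>] _ w_0 w1_0 w2_0 w3_0])
      (auto intro!: continuous_intros \<open>isCont G3 0\<close>)
  moreover have "\<forall>\<^sub>F t in at_right 0. t < \<delta>"
    using \<open>\<delta> > 0\<close> by (rule eventually_at_rightI[of 0 \<delta>, rotated]) auto
  moreover have "\<forall>\<^sub>F t in at_right 0. t > (0 :: real)"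
    by (rule eventually_at_right_less)
  ultimately have "\<forall>\<^sub>F t in at_right 0. 0 < t \<and> t < \<delta> \<and> w c0 t > 0 \<and>
      2 * w c0 t * w2 c0 t > (w1 c0 t)\<^sup>2"
    by eventually_elim auto
  \<comment> \<open>The parameter \<open>a\<close> is chosen at the critical energy and kept for all
    nearby \<open>c\<close>.\<close>
  then obtain a where a: "0 < a" "a < \<delta>" "w c0 a > 0" "2 * w c0 a * w2 c0 a > (w1 c0 a)\<^sup>2"
    using eventually_happens trivial_limit_at_right_real by blast

  \<comment> \<open>Persistence below the critical energy\<close>
  have "\<forall>\<^sub>F c in nhds c0. w c a > 0 \<and> 2 * w c a * w2 c a - (w1 c a)\<^sup>2 > 0"
  proof (intro eventually_conj)
    show "\<forall>\<^sub>F c in nhds c0. w c a > 0"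
      by (rule order_tendstoD[OF _ a(3)])
        (unfold w_def, intro tendsto_intros filterlim_ident)
    have "2 * w c0 a * w2 c0 a - (w1 c0 a)\<^sup>2 > 0" using a by simp
    then show "\<forall>\<^sub>F c in nhds c0. 2 * w c a * w2 c a - (w1 c a)\<^sup>2 > 0"
      by (rule order_tendstoD[rotated])
        (unfold w_def w1_def w2_def, intro tendsto_intros filterlim_ident)
  qed
  then obtain \<epsilon> where "\<epsilon> > 0" and \<epsilon>: "\<And>c. \<bar>c - c0\<bar> < \<epsilon> \<Longrightarrow>
      w c a > 0 \<and> 2 * w c a * w2 c a - (w1 c a)\<^sup>2 > 0"
    unfolding eventually_nhds_metric dist_real_def by blast
  \<comment> \<open>Keeps the interval around \<open>a\<close> within
    \<open>0 < t < \<delta>\<close>.\<close>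
  define e where "e = min a (\<delta> - a)"
  have "e > 0" using a by (simp add: e_def)
  have near: "2 * (v t)\<^sup>2 \<noteq> 1" if "\<bar>t - a\<bar> < e" for t
  proof (rule collision_free)
    have "0 < t" "t < \<delta>"
      using that by (auto simp: e_def)
    from small[OF this] L(2) show "2 * (norm (v t))\<^sup>2 < 1"
      by (simp add: N_def)
  qed
  have "\<not> strictly_convex_hypersurface (regularized_earth_component \<mu> c)"
    if c: "c \<in> {c0 - \<epsilon><..<c0}" for c
  proof (rule not_strictly_convex_if_not_concave[OF \<mu> _ _ \<open>e > 0\<close>])
    show "c < critical_energy \<mu>" using c by (simp add: c0_def)
    show "q \<noteq> 0" by (simp add: q_def complex_eq_iff)
    show "2 * (norm (complex_of_real x + complex_of_real a * q))\<^sup>2 < lagrange_point \<mu>"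
      using small[OF a(1,2)] by (simp add: N_def v_def L_def)
    show "((\<lambda>t. regularized_kinetic \<mu> c (complex_of_real x + complex_of_real t * q))
        has_real_derivative w1 c t) (at t)" if "\<bar>t - a\<bar> < e" for t
      unfolding kinetic by (rule dw(1)[OF near[OF that]])
    show "(w1 c has_real_derivative w2 c a) (at a)"
      using near[of a] \<open>e > 0\<close> by (intro dw(2)) simp
    show "regularized_kinetic \<mu> c (complex_of_real x + complex_of_real a * q) > 0"
      and "(w1 c a)\<^sup>2 < 2 * regularized_kinetic \<mu> c (complex_of_real x + complex_of_real a * q) * w2 c a"
      unfolding kinetic using \<epsilon>[of c] c by auto
  qed
  with \<open>\<epsilon> > 0\<close> show ?thesis
    unfolding c0_def by blast
qed

end
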